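(* Let $n\ge 1$, let $K\subset\mathbb{R}^n$ be a convex body and let $\Lambda\subset\mathbb{R}^n$ be an $n$-dimensional lattice. Let $K_s=K-K$ be the difference body of $K$ and let $\delta^l(K)$ be the lattice packing density of $K$. Then $$\frac{\mathrm{vol}(K)}{\det(\Lambda)}\le\delta^l(K)\cdot\prod_{i=1}^n\frac{1}{\rho_i(K_s,\Lambda)}.$$
   Context: A convex body in $\mathbb{R}^n$ is a compact convex set with non-empty interior; $\mathrm{vol}$ is $n$-dimensional Lebesgue measure. The difference body is $K_s=K-K=\{\mathbf{x}-\mathbf{y}:\mathbf{x},\mathbf{y}\in K\}$. An $n$-dimensional lattice $\Lambda$ is a discrete subgroup of $\mathbb{R}^n$ spanning $\mathbb{R}^n$; $\det(\Lambda)$ is the volume of a fundamental cell; $\mathcal{L}^n$ is the set of all $n$-dimensional lattices in $\mathbb{R}^n$. For a convex body $M\subset\mathbb{R}^n$ with $\mathbf{0}\in\mathrm{int}(M)$ and $\Lambda\in\mathcal{L}^n$, the first successive minimum $\lambda_1(M,\Lambda)$ is the smallest $\lambda>0$ such that $\lambda M$ contains a non-zero point of $\Lambda$. The lattice packing density of $K$ is $$\delta^l(K)=\sup\left\{\frac{\mathrm{vol}(\lambda_1(K_s,\Lambda')K)}{\det(\Lambda')}:\Lambda'\in\mathcal{L}^n\right\}.$$ Packing minima: for a convex body $M\subset\mathbb{R}^n$ with $\mathbf{0}\in\mathrm{int}(M)$, $\Lambda\in\mathcal{L}^n$ and $1\le i\le n$, $$\rho_i(M,\Lambda)=\inf\{\rho>0:(\rho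 M+L)\cap\Lambda\ne L\cap\Lambda\ \text{ for all } L\in\mathcal{G}(\mathbb{R}^n,n-i)\},$$ where $\mathcal{G}(\mathbb{R}^n,k)$ is the set of all $k$-dimensional linear subspaces of $\mathbb{R}^n$. *)

theory Defs
  imports "HOL-Analysis.Analysis"
begin

definition convex_body :: "'a::euclidean_space set \<Rightarrow> bool" where
  "convex_body K \<longleftrightarrow> compact K \<and> convex K \<and> interior K \<noteq> {}"

text \<open>For sets, \<open>K - K\<close> already denotes set difference, so the Minkowski difference is
  written out.\<close>

definition difference_body :: "'a::euclidean_space set \<Rightarrow> 'a set" where
  "difference_body K = {x - y | x y. x \<in> K \<and> y \<in> K}"

definition full_rank_lattice :: "'a::euclidean_space set \<Rightarrow> bool" where
  "full_rank_lattice \<Lambda> \<longleftrightarrow>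
     0 \<in> \<Lambda> \<and> (\<forall>x\<in>\<Lambda>. \<forall>y\<in>\<Lambda>. x - y \<in> \<Lambda>) \<and> discrete \<Lambda> \<and> span \<Lambda> = UNIV"

definition lattice_basis :: "'a::euclidean_space set \<Rightarrow> 'a set \<Rightarrow> bool" where
  "lattice_basis B \<Lambda> \<longleftrightarrow>
     independent B \<and> \<Lambda> = {\<Sum>b\<in>B. of_int (z b) *\<^sub>R b | z :: 'a \<Rightarrow> int. True}"

definition fundamental_cell :: "'a::euclidean_space set \<Rightarrow> 'a set" where
  "fundamental_cell B = {\<Sum>b\<in>B. t b *\<^sub>R b | t :: 'a \<Rightarrow> real. \<forall>b\<in>B. 0 \<le> t b \<and> t b < 1}"

text \<open>Every lattice has a basis, and all its fundamental cells have the same volume, so the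
  choice below is immaterial.\<close>

definition lattice_det :: "'a::euclidean_space set \<Rightarrow> real" where
  "lattice_det \<Lambda> = measure lebesgue (fundamental_cell (SOME B. lattice_basis B \<Lambda>))"

text \<open>The minimum is attained when \<open>M\<close> is a convex body with \<open>0\<close> in its interior and
  \<open>\<Lambda>\<close> is a lattice of full rank.\<close>

definition first_minimum :: "'a::euclidean_space set \<Rightarrow> 'a set \<Rightarrow> real" where
  "first_minimum M \<Lambda> = (LEAST r. 0 < r \<and> (\<exists>x\<in>\<Lambda>. x \<noteq> 0 \<and> x \<in> (*\<^sub>R) r ` M))"

text \<open>For a convex body \<open>K\<close> the set below is non-empty and bounded above by \<open>1\<close>, so the
  supremum in the reals is the true supremum.\<close>

definition lattice_packing_density :: "'a::euclidean_space set \<Rightarrow> real" where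
  "lattice_packing_density K =
     Sup {measure lebesgue ((*\<^sub>R) (first_minimum (difference_body K) \<Lambda>) ` K) / lattice_det \<Lambda>
          | \<Lambda>. full_rank_lattice \<Lambda>}"

text \<open>For \<open>1 \<le> i \<le> DIM('a)\<close>. The \<open>+\<close> is the Minkowski sum of sets; for a convex body \<open>M\<close>
  with \<open>0\<close> in its interior and a full-rank lattice \<open>\<Lambda>\<close>, the set of admissible \<open>r\<close> is
  non-empty.\<close>

definition packing_minimum :: "nat \<Rightarrow> 'a::euclidean_space set \<Rightarrow> 'a set \<Rightarrow> real" where
  "packing_minimum i M \<Lambda> =
     Inf {r. 0 < r \<and> (\<forall>L. subspace L \<and> dim L = DIM('a) - i \<longrightarrow>
            ((*\<^sub>R) r ` M + L) \<inter> \<Lambda> \<noteq> L \<inter> \<Lambda>)}"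

end

(* For r > 0 call a subspace L absorbing if every lattice point of r M + L lies in L, where M = K - K.
   Below rho_i there is always an absorbing subspace of dimension n - i. Absorbing subspaces for a
   fixed r are closed under intersection, so there is a least one, and it grows with r. This turns
   the subspaces witnessing rho_n, ..., rho_1 (which need not be nested) into a chain
   U_0 <= U_1 <= ... with dim U_k <= k, after replacing r_k by R_k = max (r_0, ..., r_k).
   In a basis adapted to the chain, divide each basis vector v by the largest R_k with v not in U_k.
   The image of the lattice under this diagonal map has no non-zero point in M: for such a point y,
   if R_k is the largest factor occurring in y, then its preimage lies in R_k y + U_k, hence in U_k,
   hence y lies in U_k, contradicting the choice of k. So the image lattice packs K, and its
   determinant is at most det / (r_0 ... r_{n-1}). *)

theory Submission
  imports Defs
begin

section \<open>Linear images of measurable sets\<close>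

text \<open>The library's \<open>measure_linear_image\<close> requires a well-ordered index type.\<close>

lemma linear_image_lmeasurable_scaling:
  fixes f :: "real^'n \<Rightarrow> real^'n"
  assumes "linear f"
  shows "\<exists>m. \<forall>S\<in>lmeasurable. f ` S \<in> lmeasurable \<and> measure lebesgue (f ` S) = m * measure lebesgue S"
    (is "?P f")
proof -
  have boxes: "?P h" if "linear h" "\<And>a b. measure lebesgue (h ` cbox a b) = measure lebesgue (cbox a b)"
    for h :: "real^'n \<Rightarrow> real^'n"
  proof (intro exI[of _ 1] ballI)
    fix S :: "(real^'n) set"
    assume "S \<in> lmeasurable"
    from measure_linear_sufficient[OF that(1) this, of 1] that(2)
    show "h ` S \<in> lmeasurable \<and> measure lebesgue (h ` S) = 1 * measure lebesgue S"
      by simp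
  qed
  show ?thesis
  proof (rule induct_linear_elementary[of f ?P, OF assms])
    fix f g :: "real^'n \<Rightarrow> real^'n"
    assume "?P f" "?P g"
    then obtain p q where
      "\<And>S. S \<in> lmeasurable \<Longrightarrow> f ` S \<in> lmeasurable \<and> measure lebesgue (f ` S) = p * measure lebesgue S"
      "\<And>S. S \<in> lmeasurable \<Longrightarrow> g ` S \<in> lmeasurable \<and> measure lebesgue (g ` S) = q * measure lebesgue S"
      by metis
    then have "\<forall>S\<in>lmeasurable. (f \<circ> g) ` S \<in> lmeasurable \<and>
        measure lebesgue ((f \<circ> g) ` S) = (p * q) * measure lebesgue S"
      unfolding image_comp[symmetric] by simp
    then show "?P (f \<circ> g)"
      by blast
  next
    fix f :: "real^'n \<Rightarrow> real^'n" and i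
    assume "linear f" and 0: "\<And>x. f x $ i = 0"
    have "negligible (f ` S)" for S
      by (rule negligible_subset[OF negligible_standard_hyperplane_cart[of i]]) (auto simp: 0)
    then show "?P f"
      by (intro exI[of _ 0]) (simp add: negligible_iff_measure)
  next
    fix c :: "'n \<Rightarrow> real"
    show "?P (\<lambda>x. \<chi> i. c i * x $ i)"
      using measurable_stretch measure_stretch by blast
  next
    fix m n :: 'n
    let ?\<tau> = "Transposition.transpose m n"
    let ?h = "\<lambda>x::real^'n. \<chi> i. x $ ?\<tau> i"
    have "?h ` cbox a b = cbox (?h a) (?h b)" for a b
    proof (rule set_eqI)
      fix y
      have "y = ?h x \<longleftrightarrow> x = ?h y" for x
        by (auto simp: vec_eq_iff)
      moreover have "?h y \<in> cbox a b \<longleftrightarrow> y \<in> cbox (?h a) (?h b)"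
        unfolding mem_box_cart by (metis transpose_involutory vec_lambda_beta)
      ultimately show "y \<in> ?h ` cbox a b \<longleftrightarrow> y \<in> cbox (?h a) (?h b)"
        by auto
    qed
    moreover have "measure lebesgue (cbox (?h a) (?h b)) = measure lebesgue (cbox a b)" for a b
    proof -
      have "(\<forall>i. a $ ?\<tau> i \<le> b $ ?\<tau> i) \<longleftrightarrow> (\<forall>i. a $ i \<le> b $ i)"
        by (metis transpose_involutory)
      moreover have "(\<Prod>i\<in>UNIV. b $ ?\<tau> i - a $ ?\<tau> i) = (\<Prod>i\<in>UNIV. b $ i - a $ i)"
        by (rule prod.reindex_bij_betw) auto
      ultimately show ?thesis
        by (simp add: content_cbox_if_cart interval_eq_empty_cart) (metis not_le)
    qed
    moreover have "linear ?h"
      by (rule linearI) (simp_all add: vec_eq_iff)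
    ultimately show "?P ?h"
      by (intro boxes) (simp_all only:)
  next
    fix m n :: 'n
    assume "m \<noteq> n"
    let ?h = "\<lambda>x::real^'n. \<chi> i. if i = m then x $ m + x $ n else x $ i"
    have lin: "linear ?h"
      by (rule linearI) (auto simp: vec_eq_iff algebra_simps)
    have "measure lebesgue (?h ` cbox a b) = measure lebesgue (cbox a b)" for a b
    proof (cases "cbox a b = {}")
      case False
      define w where "w = axis n (a $ n)"
      have w: "cbox a b = (+) w ` cbox (a - w) (b - w)"
        by (simp flip: cbox_translation)
      with False have "cbox (a - w) (b - w) \<noteq> {}"
        by auto
      moreover have "?h ` cbox a b = (+) (?h w) ` ?h ` cbox (a - w) (b - w)"
        unfolding w image_image using linear_add[OF lin] by (intro image_cong) auto
      moreover have "0 \<le> (a - w) $ n"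
        by (simp add: w_def)
      ultimately have "measure lebesgue (?h ` cbox a b) = measure lebesgue (cbox (a - w) (b - w))"
        using measure_shear_interval[OF \<open>m \<noteq> n\<close>, of "a - w" "b - w"] by (simp add: measure_translation)
      then show ?thesis
        by (simp only: w measure_translation)
    qed simp
    then show "?P ?h"
      by (intro boxes lin)
  qed
qed

section \<open>Bases of lattices\<close>

lemma full_rank_lattice_closed:
  assumes "full_rank_lattice \<Lambda>"
  shows "0 \<in> \<Lambda>" "x \<in> \<Lambda> \<Longrightarrow> y \<in> \<Lambda> \<Longrightarrow> x - y \<in> \<Lambda>" "x \<in> \<Lambda> \<Longrightarrow> - x \<in> \<Lambda>"
    "x \<in> \<Lambda> \<Longrightarrow> y \<in> \<Lambda> \<Longrightarrow> x + y \<in> \<Lambda>"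
proof -
  show "0 \<in> \<Lambda>" and diff: "x \<in> \<Lambda> \<Longrightarrow> y \<in> \<Lambda> \<Longrightarrow> x - y \<in> \<Lambda>" for x y
    using assms by (auto simp: full_rank_lattice_def)
  with diff[of 0] show minus: "x \<in> \<Lambda> \<Longrightarrow> - x \<in> \<Lambda>" for x
    by simp
  show "x \<in> \<Lambda> \<Longrightarrow> y \<in> \<Lambda> \<Longrightarrow> x + y \<in> \<Lambda>"
    using diff[of x "- y"] minus by simp
qed

lemma full_rank_lattice_scale_int:
  assumes "full_rank_lattice \<Lambda>" "x \<in> \<Lambda>"
  shows "of_int z *\<^sub>R x \<in> \<Lambda>"
proof -
  have nat: "of_nat k *\<^sub>R x \<in> \<Lambda>" for k
    by (induction k) (auto simp: algebra_simps full_rank_lattice_closed[OF assms(1)] assms(2))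
  show ?thesis
    by (cases z rule: int_cases2)
      (use nat full_rank_lattice_closed(3)[OF assms(1) nat] in auto)
qed

lemma full_rank_lattice_int_combination:
  assumes "full_rank_lattice \<Lambda>" "B \<subseteq> \<Lambda>"
  shows "(\<Sum>b\<in>B. of_int (z b) *\<^sub>R b) \<in> \<Lambda>"
  using assms(2)
  by (induction B rule: infinite_finite_induct)
    (auto intro: full_rank_lattice_closed[OF assms(1)] full_rank_lattice_scale_int[OF assms(1)])

lemma full_rank_lattice_finite_bounded:
  assumes \<Lambda>: "full_rank_lattice \<Lambda>" and S: "bounded S"
  shows "finite (\<Lambda> \<inter> S)"
proof -
  from \<Lambda> have "0 isolated_in \<Lambda>"
    by (auto simp: full_rank_lattice_def dest: discreteD)
  then obtain d where d: "d > 0" "\<And>y. y \<in> \<Lambda> \<Longrightarrow> dist 0 y < d \<Longrightarrow> y = 0"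
    by (rule isolated_inE_dist) blast
  have "uniform_discrete (\<Lambda> \<inter> S)"
  proof (rule uniformI1[OF d(1)])
    fix x y assume "x \<in> \<Lambda> \<inter> S" "y \<in> \<Lambda> \<inter> S" "dist x y < d"
    then show "x = y"
      using d(2)[of "x - y"] full_rank_lattice_closed(2)[OF \<Lambda>] by (simp add: dist_norm norm_minus_commute)
  qed
  then show ?thesis
    using S uniform_discrete_finite_iff bounded_Int by blast
qed

text \<open>Bases are built one vector at a time: over the previous span, the new generator is a lattice
  point with minimal positive coordinate.\<close>

lemma lattice_basis_of_section:
  assumes \<Lambda>: "full_rank_lattice \<Lambda>" and "finite B" "independent B" "B \<subseteq> \<Lambda>"
  shows "\<exists>C. finite C \<and> independent C \<and> C \<subseteq> \<Lambda> \<and> span C = span B \<and>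
    (\<forall>x\<in>\<Lambda> \<inter> span B. \<exists>z. x = (\<Sum>c\<in>C. of_int (z c) *\<^sub>R c))"
  using assms(2-)
proof (induction B rule: finite_induct)
  case empty
  then show ?case by (intro exI[of _ "{}"]) auto
next
  case (insert b B)
  then obtain C where C: "finite C" "independent C" "C \<subseteq> \<Lambda>" "span C = span B"
    and gen: "\<And>x. x \<in> \<Lambda> \<Longrightarrow> x \<in> span B \<Longrightarrow> \<exists>z. x = (\<Sum>c\<in>C. of_int (z c) *\<^sub>R c)"
    by (auto simp: independent_insert)
  from insert have b: "b \<in> \<Lambda>" "b \<notin> span C"
    using C(4) by (auto simp: independent_insert split: if_splits)
  define G where "G = {t::real. \<exists>u\<in>span C. t *\<^sub>R b + u \<in> \<Lambda>}"
  define F where "F = \<Lambda> \<inter> cball 0 (norm b + (\<Sum>c\<in>C. norm c))"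
  have "finite F"
    unfolding F_def using full_rank_lattice_finite_bounded[OF \<Lambda>] by blast
  have small: "\<exists>u\<in>span C. t *\<^sub>R b + u \<in> F" if "t \<in> G" "0 < t" "t \<le> 1" for t
  proof -
    from \<open>t \<in> G\<close> obtain u where u: "u \<in> span C" "t *\<^sub>R b + u \<in> \<Lambda>"
      by (auto simp: G_def)
    from u(1) C(1) obtain q where q: "u = (\<Sum>c\<in>C. q c *\<^sub>R c)"
      unfolding span_finite[OF C(1)] by auto
    define v where "v = (\<Sum>c\<in>C. frac (q c) *\<^sub>R c)"
    have "v = u - (\<Sum>c\<in>C. of_int \<lfloor>q c\<rfloor> *\<^sub>R c)"
      by (simp add: v_def q frac_def sum_subtractf algebra_simps)
    then have eq: "t *\<^sub>R b + v = (t *\<^sub>R b + u) - (\<Sum>c\<in>C. of_int \<lfloor>q c\<rfloor> *\<^sub>R c)"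
      by simp
    have "t *\<^sub>R b + v \<in> \<Lambda>"
      unfolding eq by (intro full_rank_lattice_closed(2)[OF \<Lambda> u(2)] full_rank_lattice_int_combination[OF \<Lambda> C(3)])
    moreover have "norm (t *\<^sub>R b) \<le> norm b"
      using that by (simp add: mult_left_le_one_le)
    moreover have "norm v \<le> (\<Sum>c\<in>C. norm c)"
      unfolding v_def by (rule sum_norm_le) (simp add: mult_left_le_one_le frac_ge_0 less_imp_le[OF frac_lt_1])
    ultimately have "t *\<^sub>R b + v \<in> F"
      using norm_triangle_ineq[of "t *\<^sub>R b" v] by (simp add: F_def)
    moreover have "v \<in> span C"
      unfolding v_def by (intro span_sum span_scale span_base)
    ultimately show ?thesis by blast
  qed
  have inj: "t = s" if "t *\<^sub>R b + u = s *\<^sub>R b + v" "u \<in> span C" "v \<in> span C" for t s u v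
  proof (rule ccontr)
    assume "t \<noteq> s"
    have "(t - s) *\<^sub>R b = v - u"
      using that(1) by (simp add: algebra_simps)
    then have "b = (1 / (t - s)) *\<^sub>R (v - u)"
      using \<open>t \<noteq> s\<close> by (simp flip: \<open>(t - s) *\<^sub>R b = v - u\<close>)
    then show False
      using b(2) that(2,3) by (metis span_scale span_diff)
  qed
  have "\<forall>t\<in>G \<inter> {0<..1}. \<exists>u. u \<in> span C \<and> t *\<^sub>R b + u \<in> F"
    using small by fastforce
  from bchoice[OF this] obtain f where f: "\<And>t. t \<in> G \<inter> {0<..1} \<Longrightarrow> f t \<in> span C \<and> t *\<^sub>R b + f t \<in> F"
    by blast
  have "inj_on (\<lambda>t. t *\<^sub>R b + f t) (G \<inter> {0<..1})"
    using f inj by (intro inj_onI) blast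
  moreover have "(\<lambda>t. t *\<^sub>R b + f t) ` (G \<inter> {0<..1}) \<subseteq> F"
    using f by blast
  ultimately have finG: "finite (G \<inter> {0<..1})"
    using \<open>finite F\<close> by (meson finite_imageD finite_subset)
  have "1 \<in> G"
    using b(1) by (auto simp: G_def intro!: bexI[of _ 0] span_zero)
  define t0 where "t0 = Min (G \<inter> {0<..1})"
  have "t0 \<in> G \<inter> {0<..1}"
    unfolding t0_def using finG \<open>1 \<in> G\<close> by (intro Min_in) auto
  then obtain u0 where t0: "0 < t0" "t0 \<le> 1" and u0: "u0 \<in> span C" "t0 *\<^sub>R b + u0 \<in> \<Lambda>"
    by (auto simp: G_def)
  have t0_min: "t0 \<le> t" if "t \<in> G" "0 < t" for t
  proof (cases "t \<le> 1")
    case True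
    then show ?thesis
      unfolding t0_def using finG that by (intro Min_le) auto
  qed (use t0 in auto)
  define a where "a = t0 *\<^sub>R b + u0"
  have a: "a \<in> \<Lambda>" "a \<notin> span C"
  proof -
    show "a \<notin> span C"
      using inj[of t0 u0 0 a] t0 u0(1) by (auto simp: a_def)
  qed (use u0 in \<open>simp add: a_def\<close>)
  have b_eq: "b = (1 / t0) *\<^sub>R (a - u0)"
    using t0 by (simp add: a_def)
  have span_eq: "span (insert a C) = span (insert b C)"
  proof -
    have "u0 \<in> span (insert b C)" "u0 \<in> span (insert a C)"
      using u0(1) span_mono by blast+
    then have "a - u0 \<in> span (insert a C)"
      by (simp add: span_diff span_base)
    then have "b \<in> span (insert a C)"
      by (subst b_eq) (rule span_scale)
    moreover have "a \<in> span (insert b C)"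
      unfolding a_def using \<open>u0 \<in> span (insert b C)\<close> by (intro span_add span_scale) (auto intro: span_base)
    ultimately show ?thesis
      unfolding span_eq by (auto intro: span_base)
  qed
  also have "\<dots> = span (insert b B)"
    using C(4) by (metis span_insert)
  finally have span_a: "span (insert a C) = span (insert b B)" .
  show ?case
  proof (intro exI[of _ "insert a C"] conjI ballI)
    show "independent (insert a C)"
      using C(2) a(2) by (simp add: independent_insert)
  next
    fix x assume "x \<in> \<Lambda> \<inter> span (insert b B)"
    then have x: "x \<in> \<Lambda>" "x \<in> span (insert a C)"
      by (auto simp: span_a)
    then obtain s where s: "x - s *\<^sub>R a \<in> span C"
      by (auto simp: span_insert)
    define k where "k = \<lfloor>s\<rfloor>"
    define y where "y = x - of_int k *\<^sub>R a"
    have y: "y \<in> \<Lambda>"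
      unfolding y_def by (intro full_rank_lattice_closed[OF \<Lambda>] full_rank_lattice_scale_int[OF \<Lambda>] x a)
    have y_eq: "y = ((s - of_int k) * t0) *\<^sub>R b + ((s - of_int k) *\<^sub>R u0 + (x - s *\<^sub>R a))"
      by (simp add: y_def a_def algebra_simps)
    have v: "(s - of_int k) *\<^sub>R u0 + (x - s *\<^sub>R a) \<in> span C"
      by (intro span_add span_scale u0 s)
    have "(s - of_int k) * t0 \<in> G"
      using y v by (auto simp: G_def y_eq)
    moreover have "(s - of_int k) * t0 < t0" "0 \<le> (s - of_int k) * t0"
      using t0 by (auto simp: k_def mult_less_cancel_right1) linarith+
    ultimately have "(s - of_int k) * t0 = 0"
      using t0_min by fastforce
    then have "y \<in> span B"
      using v C(4) unfolding y_eq by (simp only: scaleR_zero_left add_0)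
    with y gen obtain z where z: "y = (\<Sum>c\<in>C. of_int (z c) *\<^sub>R c)"
      by blast
    have "a \<notin> C"
      using a(2) span_base by blast
    then have "x = (\<Sum>c\<in>insert a C. of_int ((z(a := k)) c) *\<^sub>R c)"
      using C(1) z by (simp add: y_def algebra_simps) (auto intro!: sum.cong)
    then show "\<exists>z. x = (\<Sum>c\<in>insert a C. of_int (z c) *\<^sub>R c)"
      by blast
  qed (use C a span_a in auto)
qed

lemma lattice_basis_exists:
  assumes \<Lambda>: "full_rank_lattice \<Lambda>"
  shows "\<exists>B. lattice_basis B \<Lambda>"
proof -
  obtain B where B: "B \<subseteq> \<Lambda>" "independent B" "\<Lambda> \<subseteq> span B"
    using maximal_independent_subset by blast
  have "span B = UNIV"
    using \<Lambda> span_mono[OF B(3)] by (simp add: full_rank_lattice_def span_span top.extremum_unique)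
  moreover have "finite B"
    using B(2) independent_imp_finite by blast
  ultimately obtain C where "independent C" "C \<subseteq> \<Lambda>"
    "\<And>x. x \<in> \<Lambda> \<Longrightarrow> \<exists>z. x = (\<Sum>c\<in>C. of_int (z c) *\<^sub>R c)"
    using lattice_basis_of_section[OF \<Lambda> _ B(2,1)] by auto
  then have "lattice_basis C \<Lambda>"
    using full_rank_lattice_int_combination[OF \<Lambda>] by (auto simp: lattice_basis_def)
  then show ?thesis ..
qed

lemma lattice_basis_props:
  assumes "full_rank_lattice \<Lambda>" "lattice_basis B \<Lambda>"
  shows "independent B" "finite B" "B \<subseteq> \<Lambda>" "span B = UNIV"
proof -
  show ind: "independent B" and fin: "finite B"
    using assms(2) independent_imp_finite by (auto simp: lattice_basis_def)
  have "(\<Sum>b\<in>B. of_int (z b) *\<^sub>R b) \<in> span B" for z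
    by (intro span_sum span_scale span_base)
  then have "\<Lambda> \<subseteq> span B"
    using assms(2) by (auto simp: lattice_basis_def)
  then show "span B = UNIV"
    using assms(1) span_mono[of \<Lambda> "span B"]
    by (simp add: full_rank_lattice_def span_span top.extremum_unique)
  show "B \<subseteq> \<Lambda>"
  proof
    fix b assume "b \<in> B"
    then have "b = (\<Sum>c\<in>B. of_int (if c = b then 1 else 0) *\<^sub>R c)"
      using fin by (simp add: if_distrib[of of_int] if_distrib[of "\<lambda>t. t *\<^sub>R _"] cong: if_cong)
    then show "b \<in> \<Lambda>"
      using assms(2) by (auto simp: lattice_basis_def intro!: exI[of _ "\<lambda>c. if c = b then 1 else 0"])
  qed
qed

section \<open>Fundamental cells\<close>

lemma continuous_on_representation:
  fixes B :: "'a::euclidean_space set"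
  assumes "independent B" "span B = UNIV"
  shows "continuous_on S (\<lambda>x. representation B x b)"
proof -
  have "linear (\<lambda>x. representation B x b)"
    using assms by (intro linearI) (simp_all add: representation_add representation_scale)
  then show ?thesis
    by (simp add: linear_continuous_on linear_conv_bounded_linear)
qed

lemma representation_sum_basis:
  assumes "independent B" "finite B" "b \<in> B"
  shows "representation B (\<Sum>c\<in>B. t c *\<^sub>R c) b = t b"
proof -
  have "representation B (\<Sum>c\<in>B. t c *\<^sub>R c) = (\<lambda>c. if c \<in> B then t c else 0)"
    using assms(1,2)
  proof (intro representation_eqI)
    show "(\<Sum>c\<in>B. t c *\<^sub>R c) \<in> span B"
      by (intro span_sum span_scale span_base)
    show "(\<Sum>c | (if c \<in> B then t c else 0) \<noteq> 0. (if c \<in> B then t c else 0) *\<^sub>R c) = (\<Sum>c\<in>B. t c *\<^sub>R c)"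
      using assms(2) by (intro sum.mono_neutral_cong_left) (auto split: if_splits)
  qed (auto intro!: finite_subset[OF _ assms(2)] split: if_splits)
  then show ?thesis
    using assms(3) by simp
qed

lemma sum_representation:
  assumes "independent B" "finite B" "span B = UNIV"
  shows "(\<Sum>b\<in>B. representation B x b *\<^sub>R b) = x"
  using assms sum_representation_eq[of B x B] by simp

lemma fundamental_cell_eq:
  fixes B :: "'a::euclidean_space set"
  assumes "independent B" "span B = UNIV"
  shows "fundamental_cell B = {x. \<forall>b\<in>B. 0 \<le> representation B x b \<and> representation B x b < 1}"
proof -
  have "finite B"
    using assms(1) independent_imp_finite by blast
  show ?thesis
  proof (intro set_eqI iffI)
    fix x assume "x \<in> fundamental_cell B"
    then obtain t where "x = (\<Sum>b\<in>B. t b *\<^sub>R b)" "\<forall>b\<in>B. 0 \<le> t b \<and> t b < 1"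
      unfolding fundamental_cell_def by blast
    then show "x \<in> {x. \<forall>b\<in>B. 0 \<le> representation B x b \<and> representation B x b < 1}"
      by (simp add: representation_sum_basis assms \<open>finite B\<close>)
  next
    fix x assume "x \<in> {x. \<forall>b\<in>B. 0 \<le> representation B x b \<and> representation B x b < 1}"
    then show "x \<in> fundamental_cell B"
      unfolding fundamental_cell_def mem_Collect_eq
      by (intro exI[of _ "representation B x"]) (simp add: sum_representation assms \<open>finite B\<close>)
  qed
qed

lemma bounded_fundamental_cell:
  "bounded (fundamental_cell (B :: 'a::euclidean_space set))"
  unfolding bounded_iff fundamental_cell_def
proof (intro exI ballI)
  fix x assume "x \<in> {\<Sum>b\<in>B. t b *\<^sub>R b | t. \<forall>b\<in>B. 0 \<le> t b \<and> t b < 1}"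
  then obtain t where "x = (\<Sum>b\<in>B. t b *\<^sub>R b)" and t: "\<forall>b\<in>B. 0 \<le> t b \<and> t b < 1"
    by blast
  moreover have "norm (t b *\<^sub>R b) \<le> norm b" if "b \<in> B" for b
    using t that mult_right_mono[of "t b" 1 "norm b"] by (simp add: less_imp_le)
  ultimately show "norm x \<le> (\<Sum>b\<in>B. norm b)"
    by (auto intro: sum_norm_le)
qed

lemma lmeasurable_fundamental_cell:
  fixes B :: "'a::euclidean_space set"
  assumes "independent B" "span B = UNIV"
  shows "fundamental_cell B \<in> lmeasurable"
proof (rule bounded_set_imp_lmeasurable[OF bounded_fundamental_cell])
  have "finite B"
    using assms(1) independent_imp_finite by blast
  have [measurable]: "(\<lambda>x. representation B x b) \<in> borel_measurable borel" for b
    by (intro borel_measurable_continuous_onI continuous_on_representation assms)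
  have "Measurable.pred borel (\<lambda>x::'a. \<forall>b\<in>B. 0 \<le> representation B x b \<and> representation B x b < 1)"
    using \<open>finite B\<close> by measurable
  then show "fundamental_cell B \<in> sets lebesgue"
    unfolding fundamental_cell_eq[OF assms] pred_def by simp
qed

lemma measure_fundamental_cell_pos:
  fixes B :: "'a::euclidean_space set"
  assumes "independent B" "span B = UNIV"
  shows "0 < measure lebesgue (fundamental_cell B)"
proof -
  have fin: "finite B"
    using assms(1) independent_imp_finite by blast
  define O' where "O' = (\<Inter>b\<in>B. {x. 0 < representation B x b} \<inter> {x. representation B x b < 1})"
  have "open O'"
    unfolding O'_def using fin
    by (intro open_INT open_Int ballI open_Collect_less continuous_on_const continuous_on_representation assms)
  moreover have "O' \<subseteq> fundamental_cell B"
    by (auto simp: O'_def fundamental_cell_eq[OF assms] less_imp_le)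
  moreover have "(\<Sum>b\<in>B. (1/2) *\<^sub>R b) \<in> O'"
    by (auto simp: O'_def representation_sum_basis[OF assms(1) fin])
  ultimately have "\<not> negligible (fundamental_cell B)"
    by (metis empty_iff negligible_subset open_not_negligible)
  then show ?thesis
    using lmeasurable_fundamental_cell[OF assms] negligible_iff_measure
    by (metis measure_nonneg order_le_less)
qed

lemma fundamental_cell_cover:
  assumes "full_rank_lattice \<Lambda>" "lattice_basis B \<Lambda>"
  shows "\<exists>v\<in>\<Lambda>. x - v \<in> fundamental_cell B"
proof -
  note B = lattice_basis_props[OF assms]
  let ?t = "representation B x"
  let ?v = "\<Sum>b\<in>B. of_int \<lfloor>?t b\<rfloor> *\<^sub>R b"
  have "x - ?v = (\<Sum>b\<in>B. frac (?t b) *\<^sub>R b)"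
    by (subst (1) sum_representation[OF B(1,2,4), of x, symmetric])
      (simp add: frac_def algebra_simps flip: sum_subtractf)
  moreover have "0 \<le> frac (?t b) \<and> frac (?t b) < 1" for b
    by (simp add: frac_ge_0 frac_lt_1)
  ultimately have "x - ?v \<in> fundamental_cell B"
    unfolding fundamental_cell_def mem_Collect_eq by (intro exI[of _ "\<lambda>b. frac (?t b)"]) simp
  then show ?thesis
    using full_rank_lattice_int_combination[OF assms(1) B(3)] by (intro bexI[of _ ?v])
qed

lemma fundamental_cell_unique:
  assumes "full_rank_lattice \<Lambda>" "lattice_basis B \<Lambda>"
    and "x \<in> fundamental_cell B" "y \<in> fundamental_cell B" "x - y \<in> \<Lambda>"
  shows "x = y"
proof -
  note B = lattice_basis_props[OF assms(1,2)]
  obtain z :: "'a \<Rightarrow> int" where z: "x - y = (\<Sum>b\<in>B. of_int (z b) *\<^sub>R b)"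
    using assms(2,5) by (auto simp: lattice_basis_def)
  have "representation B x b = representation B y b" if "b \<in> B" for b
  proof -
    have "representation B x b - representation B y b = of_int (z b)"
      using arg_cong[OF z, of "\<lambda>v. representation B v b"] representation_sum_basis[OF B(1,2) that]
        representation_diff[OF B(1)] B(4) by simp
    moreover have "\<bar>representation B x b - representation B y b\<bar> < 1"
      using assms(3,4) that by (force simp: fundamental_cell_eq[OF B(1,4)] abs_less_iff)
    ultimately have "\<bar>real_of_int (z b)\<bar> < 1"
      by simp
    then have "z b = 0"
      by linarith
    then show ?thesis
      using \<open>representation B x b - representation B y b = of_int (z b)\<close> by simp
  qed
  then show ?thesis
    by (metis (no_types, lifting) sum.cong sum_representation[OF B(1,2,4)])
qed

text \<open>Moving the pieces of \<open>S\<close> in the various cells into one cell keeps them disjoint.\<close>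

lemma lattice_packing_measure_le:
  assumes \<Lambda>: "full_rank_lattice \<Lambda>" and B: "lattice_basis B \<Lambda>"
    and S: "bounded S" "S \<in> lmeasurable"
    and packing: "\<And>x y. x \<in> S \<Longrightarrow> y \<in> S \<Longrightarrow> x - y \<in> \<Lambda> \<Longrightarrow> x = y"
  shows "measure lebesgue S \<le> measure lebesgue (fundamental_cell B)"
proof -
  let ?C = "fundamental_cell B"
  have C: "?C \<in> lmeasurable"
    using lmeasurable_fundamental_cell lattice_basis_props[OF \<Lambda> B] by blast
  define F where "F = \<Lambda> \<inter> {x - c | x c. x \<in> S \<and> c \<in> ?C}"
  have "bounded {x - c | x c. x \<in> S \<and> c \<in> ?C}"
    by (rule bounded_subset[OF bounded_minus[OF S(1) bounded_fundamental_cell[of B]]]) auto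
  then have "finite F"
    unfolding F_def by (rule full_rank_lattice_finite_bounded[OF \<Lambda>])
  define P where "P v = S \<inter> (+) v ` ?C" for v
  define Q where "Q v = (+) (- v) ` P v" for v
  have P: "P v \<in> lmeasurable" for v
    unfolding P_def using S(2) C by (intro fmeasurable.Int measurable_translation)
  have Q: "Q v \<in> lmeasurable" for v
    unfolding Q_def by (intro measurable_translation P)
  have Q_iff: "x \<in> Q v \<longleftrightarrow> x \<in> ?C \<and> v + x \<in> S" for x v
    by (force simp: Q_def P_def image_iff)
  have "S \<subseteq> (\<Union>v\<in>F. P v)"
  proof
    fix x assume "x \<in> S"
    obtain v where v: "v \<in> \<Lambda>" "x - v \<in> ?C"
      using fundamental_cell_cover[OF \<Lambda> B] by blast
    have "v = x - (x - v)" "x = v + (x - v)"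
      by simp_all
    with v \<open>x \<in> S\<close> have "v \<in> F" "x \<in> P v"
      unfolding F_def P_def by blast+
    then show "x \<in> (\<Union>v\<in>F. P v)"
      by blast
  qed
  then have "measure lebesgue S \<le> measure lebesgue (\<Union>v\<in>F. P v)"
    using S P \<open>finite F\<close> by (intro measure_mono_fmeasurable fmeasurable.finite_UN) auto
  also have "\<dots> \<le> (\<Sum>v\<in>F. measure lebesgue (P v))"
    using P \<open>finite F\<close> by (intro measure_UNION_le) auto
  also have "\<dots> = (\<Sum>v\<in>F. measure lebesgue (Q v))"
    by (simp only: Q_def measure_translation)
  also have "\<dots> = measure lebesgue (\<Union>v\<in>F. Q v)"
  proof (rule measure_UNION'[symmetric])
    show "pairwise (\<lambda>v w. disjnt (Q v) (Q w)) F"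
    proof (clarsimp simp: pairwise_def disjnt_iff Q_iff)
      fix v w x assume "v \<in> F" "w \<in> F" "v \<noteq> w" "v + x \<in> S" "w + x \<in> S"
      then show False
        using packing[of "v + x" "w + x"] full_rank_lattice_closed(2)[OF \<Lambda>, of v w] by (simp add: F_def)
    qed
  qed (use Q \<open>finite F\<close> in auto)
  also have "\<dots> \<le> measure lebesgue ?C"
    using Q C \<open>finite F\<close> by (intro measure_mono_fmeasurable fmeasurableD fmeasurable.finite_UN) (auto simp: Q_iff)
  finally show ?thesis .
qed

lemma lattice_det_eq:
  assumes \<Lambda>: "full_rank_lattice \<Lambda>" and B: "lattice_basis B \<Lambda>"
  shows "lattice_det \<Lambda> = measure lebesgue (fundamental_cell B)"
proof -
  have le: "measure lebesgue (fundamental_cell C) \<le> measure lebesgue (fundamental_cell D)"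
    if "lattice_basis C \<Lambda>" "lattice_basis D \<Lambda>" for C D
    using that lattice_basis_props[OF \<Lambda> that(1)] fundamental_cell_unique[OF \<Lambda> that(1)]
    by (intro lattice_packing_measure_le[OF \<Lambda>] bounded_fundamental_cell lmeasurable_fundamental_cell)
  have "lattice_basis (SOME B. lattice_basis B \<Lambda>) \<Lambda>"
    using B by (rule someI)
  then show ?thesis
    unfolding lattice_det_def using B le by (meson order_antisym)
qed

lemma lattice_det_pos:
  assumes "full_rank_lattice \<Lambda>"
  shows "0 < lattice_det \<Lambda>"
  using lattice_basis_exists[OF assms] lattice_basis_props[OF assms] measure_fundamental_cell_pos
  by (metis assms lattice_det_eq)

lemma linear_image_combinations:
  fixes f :: "'a::euclidean_space \<Rightarrow> 'a"
  assumes "linear f" "inj f"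
  shows "f ` {\<Sum>b\<in>B. c (z b) *\<^sub>R b | z. P z} = {\<Sum>b\<in>f ` B. c (z (inv f b)) *\<^sub>R b | z. P z}"
proof -
  have "f (\<Sum>b\<in>B. c (z b) *\<^sub>R b) = (\<Sum>b\<in>f ` B. c (z (inv f b)) *\<^sub>R b)" for z
    using assms by (simp add: sum.reindex inj_on_subset linear_sum linear_scale)
  then show ?thesis
    by (auto simp: image_iff) metis
qed

lemma fundamental_cell_linear_image:
  fixes f :: "'a::euclidean_space \<Rightarrow> 'a"
  assumes "linear f" "inj f"
  shows "fundamental_cell (f ` B) = f ` fundamental_cell B"
proof -
  have "f ` fundamental_cell B =
      {\<Sum>b\<in>f ` B. t (inv f b) *\<^sub>R b | t. \<forall>b\<in>B. 0 \<le> t b \<and> t b < 1}"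
    unfolding fundamental_cell_def using linear_image_combinations[OF assms, where c = "\<lambda>t. t"] .
  also have "\<dots> = fundamental_cell (f ` B)"
    unfolding fundamental_cell_def
  proof (intro subset_antisym subsetI; clarify)
    fix t :: "_ \<Rightarrow> real" assume "\<forall>b\<in>B. 0 \<le> t b \<and> t b < 1"
    then show "\<exists>s. (\<Sum>b\<in>f ` B. t (inv f b) *\<^sub>R b) = (\<Sum>b\<in>f ` B. s b *\<^sub>R b) \<and> (\<forall>b\<in>f ` B. 0 \<le> s b \<and> s b < 1)"
      using assms(2) by (intro exI[of _ "t \<circ> inv f"]) auto
  next
    fix s :: "_ \<Rightarrow> real" assume "\<forall>b\<in>f ` B. 0 \<le> s b \<and> s b < 1"
    then show "\<exists>t. (\<Sum>b\<in>f ` B. s b *\<^sub>R b) = (\<Sum>b\<in>f ` B. t (inv f b) *\<^sub>R b) \<and> (\<forall>b\<in>B. 0 \<le> t b \<and> t b < 1)"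
      using assms(2) by (intro exI[of _ "s \<circ> f"]) (auto intro!: sum.cong)
  qed
  finally show ?thesis ..
qed

lemma lattice_basis_linear_image:
  fixes f :: "'a::euclidean_space \<Rightarrow> 'a"
  assumes "linear f" "inj f" "lattice_basis B \<Lambda>"
  shows "lattice_basis (f ` B) (f ` \<Lambda>)"
proof -
  have B: "independent B" "\<Lambda> = {\<Sum>b\<in>B. of_int (z b) *\<^sub>R b | z. True}"
    using assms(3) by (auto simp: lattice_basis_def)
  have "f ` \<Lambda> = {\<Sum>b\<in>f ` B. of_int (z (inv f b)) *\<^sub>R b | z. True}"
    unfolding B(2) using linear_image_combinations[OF assms(1,2), where c = of_int] .
  also have "\<dots> = {\<Sum>b\<in>f ` B. of_int (z b) *\<^sub>R b | z. True}"
  proof (intro subset_antisym subsetI; clarify)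
    fix z :: "_ \<Rightarrow> int"
    show "\<exists>w. (\<Sum>b\<in>f ` B. of_int (z (inv f b)) *\<^sub>R b) = (\<Sum>b\<in>f ` B. of_int (w b) *\<^sub>R b) \<and> True"
      by (intro exI[of _ "z \<circ> inv f"]) auto
    show "\<exists>w. (\<Sum>b\<in>f ` B. of_int (z b) *\<^sub>R b) = (\<Sum>b\<in>f ` B. of_int (w (inv f b)) *\<^sub>R b) \<and> True"
      using assms(2) by (intro exI[of _ "z \<circ> f"]) (auto intro!: sum.cong)
  qed
  moreover have "independent (f ` B)"
    by (rule linear_independent_injective_image[OF assms(1) B(1) inj_on_subset[OF assms(2) subset_UNIV]])
  ultimately show ?thesis
    by (simp add: lattice_basis_def)
qed

lemma full_rank_lattice_linear_image:
  fixes f :: "'a::euclidean_space \<Rightarrow> 'a"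
  assumes "linear f" "inj f" "full_rank_lattice \<Lambda>"
  shows "full_rank_lattice (f ` \<Lambda>)"
proof -
  note closed = full_rank_lattice_closed[OF assms(3)]
  obtain e where e: "e > 0" "\<And>x. e * norm x \<le> norm (f x)"
    using linear_inj_bounded_below_pos[OF assms(1,2)] by blast
  have "x isolated_in f ` \<Lambda>" if x: "x \<in> f ` \<Lambda>" for x
  proof -
    obtain v where v: "v \<in> \<Lambda>" "x = f v"
      using x by blast
    have "discrete \<Lambda>"
      using assms(3) by (simp add: full_rank_lattice_def)
    from isolated_inE_dist[OF discreteD[OF this v(1)]] obtain d
      where d: "d > 0" "\<And>y. y \<in> \<Lambda> \<Longrightarrow> dist v y < d \<Longrightarrow> y = v"
      by blast
    have "y = x" if "y \<in> f ` \<Lambda>" "dist x y < e * d" for y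
    proof -
      obtain w where w: "w \<in> \<Lambda>" "y = f w"
        using \<open>y \<in> f ` \<Lambda>\<close> by blast
      have "e * dist v w \<le> dist x y"
        using e(2)[of "v - w"] v(2) w(2) assms(1) by (simp add: dist_norm linear_diff)
      then have "e * dist v w < e * d"
        using \<open>dist x y < e * d\<close> by linarith
      then have "dist v w < d"
        using e(1) by simp
      then show ?thesis
        using d(2) w v by blast
    qed
    then show ?thesis
      using x e(1) d(1) unfolding isolated_in_dist_Ex_iff by (intro conjI exI[of _ "e * d"]) auto
  qed
  then have "discrete (f ` \<Lambda>)"
    by (rule discreteI)
  moreover have "span (f ` \<Lambda>) = UNIV"
    using assms linear_injective_imp_surjective[OF assms(1,2)]
    by (simp add: linear_span_image full_rank_lattice_def)
  moreover have "0 \<in> f ` \<Lambda>"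
    using closed(1) linear_0[OF assms(1)] by (metis image_eqI)
  moreover have "x - y \<in> f ` \<Lambda>" if "x \<in> f ` \<Lambda>" "y \<in> f ` \<Lambda>" for x y
  proof -
    obtain v w where "v \<in> \<Lambda>" "w \<in> \<Lambda>" "x = f v" "y = f w"
      using \<open>x \<in> f ` \<Lambda>\<close> \<open>y \<in> f ` \<Lambda>\<close> by blast
    then show ?thesis
      using closed(2)[of v w] linear_diff[OF assms(1), of v w] by (metis imageI)
  qed
  ultimately show ?thesis
    by (simp add: full_rank_lattice_def)
qed

lemma measure_diagonal_image:
  fixes f :: "real^'n \<Rightarrow> real^'n" and b :: "'n \<Rightarrow> real^'n"
  assumes f: "linear f" "\<And>i. f (b i) = c i *\<^sub>R b i" and b: "inj b" "independent (range b)"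
    and S: "S \<in> lmeasurable"
  shows "measure lebesgue (f ` S) = \<bar>\<Prod>i\<in>UNIV. c i\<bar> * measure lebesgue S"
proof -
  define p where "p x = (\<Sum>i\<in>UNIV. (x $ i) *\<^sub>R b i)" for x :: "real^'n"
  define d where "d x = (\<chi> i. c i * x $ i)" for x :: "real^'n"
  have "linear p"
    unfolding p_def by (intro linearI) (simp_all add: algebra_simps sum.distrib scaleR_sum_right)
  moreover have "surj p"
  proof -
    have "card (range b) = CARD('n)"
      using b(1) by (rule card_image)
    then have "UNIV \<subseteq> span (range b)"
      using b(2) by (intro card_ge_dim_independent) simp_all
    then have "y \<in> range (\<lambda>u. \<Sum>v\<in>range b. u v *\<^sub>R v)" for y
      using span_finite[of "range b"] by auto
    then have "\<exists>x. y = p x" for y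
    proof -
      obtain u where "y = (\<Sum>v\<in>range b. u v *\<^sub>R v)"
        using \<open>y \<in> range _\<close> by blast
      then have "y = p (\<chi> i. u (b i))"
        using b(1) by (simp add: p_def sum.reindex)
      then show ?thesis ..
    qed
    then show ?thesis
      unfolding surj_def by blast
  qed
  ultimately obtain q where q: "linear q" "\<And>x. q (p x) = x"
    using linear_injective_left_inverse[OF \<open>linear p\<close>] linear_surjective_imp_injective[OF \<open>linear p\<close>]
    by (metis comp_apply id_apply)
  obtain mf mp mq where
    mf: "\<And>S. S \<in> lmeasurable \<Longrightarrow> measure lebesgue (f ` S) = mf * measure lebesgue S" and
    mp: "\<And>S. S \<in> lmeasurable \<Longrightarrow> p ` S \<in> lmeasurable \<and> measure lebesgue (p ` S) = mp * measure lebesgue S" and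
    mq: "\<And>S. S \<in> lmeasurable \<Longrightarrow> measure lebesgue (q ` S) = mq * measure lebesgue S"
    using linear_image_lmeasurable_scaling[OF f(1)] linear_image_lmeasurable_scaling[OF \<open>linear p\<close>]
      linear_image_lmeasurable_scaling[OF q(1)] by blast
  let ?Q = "cbox 0 1 :: (real^'n) set"
  have Q: "measure lebesgue ?Q = 1"
    by (simp add: content_cbox_if_cart interval_eq_empty_cart)
  have "q ` p ` ?Q = ?Q"
    using q(2) by (simp add: image_image)
  then have "mq * mp = 1"
    using mp[of ?Q] mq[of "p ` ?Q"] Q by simp
  have "f (p x) = p (d x)" for x
    by (simp add: p_def d_def linear_sum[OF f(1)] linear_scale[OF f(1)] f(2) mult.commute)
  then have "f ` p ` ?Q = p ` d ` ?Q"
    by (simp add: image_image)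
  moreover have "measure lebesgue (d ` ?Q) = \<bar>\<Prod>i\<in>UNIV. c i\<bar> * measure lebesgue ?Q" "d ` ?Q \<in> lmeasurable"
    unfolding d_def by (simp_all only: measure_stretch measurable_stretch lmeasurable_cbox)
  ultimately have "measure lebesgue (f ` p ` ?Q) = mp * \<bar>\<Prod>i\<in>UNIV. c i\<bar>"
    using mp[of "d ` ?Q"] Q by simp
  moreover have "measure lebesgue (f ` p ` ?Q) = mf * mp"
    using mf[of "p ` ?Q"] mp[of ?Q] Q by simp
  ultimately have "mf * mp = mp * \<bar>\<Prod>i\<in>UNIV. c i\<bar>"
    by simp
  then have "mf = \<bar>\<Prod>i\<in>UNIV. c i\<bar>"
    using \<open>mq * mp = 1\<close> by (metis mult.commute mult_cancel_left mult_zero_right zero_neq_one)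
  then show ?thesis
    using mf S by simp
qed

lemma lattice_det_diagonal_image:
  fixes f :: "real^'n \<Rightarrow> real^'n" and b :: "'n \<Rightarrow> real^'n"
  assumes f: "linear f" "inj f" "\<And>i. f (b i) = c i *\<^sub>R b i" and b: "inj b" "independent (range b)"
    and \<Lambda>: "full_rank_lattice \<Lambda>"
  shows "lattice_det (f ` \<Lambda>) = \<bar>\<Prod>i\<in>UNIV. c i\<bar> * lattice_det \<Lambda>"
proof -
  obtain B where B: "lattice_basis B \<Lambda>"
    using lattice_basis_exists[OF \<Lambda>] by blast
  have "lattice_det (f ` \<Lambda>) = measure lebesgue (f ` fundamental_cell B)"
    using lattice_det_eq[OF full_rank_lattice_linear_image[OF f(1,2) \<Lambda>] lattice_basis_linear_image[OF f(1,2) B]]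
    by (simp add: fundamental_cell_linear_image[OF f(1,2)])
  also have "\<dots> = \<bar>\<Prod>i\<in>UNIV. c i\<bar> * lattice_det \<Lambda>"
    unfolding lattice_det_eq[OF \<Lambda> B] using lattice_basis_props[OF \<Lambda> B]
    by (intro measure_diagonal_image[where f = f and b = b and c = c] f b lmeasurable_fundamental_cell)
  finally show ?thesis .
qed

section \<open>First minimum and packing density\<close>

lemma difference_body_props:
  fixes K :: "'a::euclidean_space set"
  assumes "convex_body K"
  shows "compact (difference_body K)" "convex (difference_body K)" "0 \<in> interior (difference_body K)"
proof -
  have K: "compact K" "convex K" "interior K \<noteq> {}"
    using assms by (auto simp: convex_body_def)
  show "compact (difference_body K)"
    unfolding difference_body_def using K by (intro compact_differences)
  have "difference_body K = (\<Union>x\<in>K. \<Union>y\<in>K. {x - y})"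
    by (auto simp: difference_body_def)
  then show "convex (difference_body K)"
    using convex_differences[OF K(2,2)] by simp
  obtain x where "x \<in> interior K"
    using K(3) by blast
  then obtain e where e: "e > 0" "ball x e \<subseteq> K" "x \<in> K"
    using interior_subset by (force simp: mem_interior)
  have "ball (0::'a) e \<subseteq> difference_body K"
  proof
    fix y :: 'a assume "y \<in> ball 0 e"
    then have "x + y \<in> K"
      using e(2) by (auto simp: dist_norm)
    then have "(x + y) - x \<in> difference_body K"
      unfolding difference_body_def using e(3) by blast
    then show "y \<in> difference_body K"
      by simp
  qed
  with e(1) show "0 \<in> interior (difference_body K)"
    by (auto simp: mem_interior)
qed

lemma convex_scaling_mono:
  fixes M :: "'a::real_vector set"
  assumes "convex M" "0 \<in> M" "0 \<le> r" "r \<le> s"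
  shows "(*\<^sub>R) r ` M \<subseteq> (*\<^sub>R) s ` M"
proof (cases "s = 0")
  case False
  have "r *\<^sub>R x = s *\<^sub>R ((r / s) *\<^sub>R x)" for x :: 'a
    using False by simp
  moreover have "(r / s) *\<^sub>R x \<in> M" if "x \<in> M" for x
    using convexD[OF assms(1,2) that, of "1 - r / s" "r / s"] assms(3,4) False by simp
  ultimately show ?thesis
    by (smt (verit) image_iff subsetI)
qed (use assms in simp)

lemma exists_scaling_contains:
  fixes M :: "'a::real_normed_vector set"
  assumes "0 \<in> interior M" "finite A"
  shows "\<exists>r>0. A \<subseteq> (*\<^sub>R) r ` M"
proof -
  obtain e where e: "e > 0" "ball 0 e \<subseteq> M"
    using assms(1) by (auto simp: mem_interior)
  define s where "s = (\<Sum>a\<in>A. norm a) + 1"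
  have s: "s > 0"
    unfolding s_def using sum_nonneg[of A norm] by simp
  have "a \<in> (*\<^sub>R) (s / e) ` M" if "a \<in> A" for a
  proof
    show "a = (s / e) *\<^sub>R ((e / s) *\<^sub>R a)"
      using e s by simp
    have "norm a < s"
      unfolding s_def using member_le_sum[OF that, of norm] assms(2) by simp
    then have "norm ((e / s) *\<^sub>R a) < e"
      using e s by (simp add: field_simps)
    then show "(e / s) *\<^sub>R a \<in> M"
      using e(2) by auto
  qed
  then show ?thesis
    using e s by (intro exI[of _ "s / e"]) auto
qed

lemma first_minimum_props:
  fixes M \<Lambda> :: "'a::euclidean_space set"
  assumes \<Lambda>: "full_rank_lattice \<Lambda>" and M: "compact M" "convex M" "0 \<in> interior M"
  shows "0 < first_minimum M \<Lambda>"
    and "\<exists>x\<in>\<Lambda>. x \<noteq> 0 \<and> x \<in> (*\<^sub>R) (first_minimum M \<Lambda>) ` M"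
    and "\<And>r x. 0 < r \<Longrightarrow> x \<in> \<Lambda> \<Longrightarrow> x \<noteq> 0 \<Longrightarrow> x \<in> (*\<^sub>R) r ` M \<Longrightarrow> first_minimum M \<Lambda> \<le> r"
proof -
  let ?P = "\<lambda>r. 0 < r \<and> (\<exists>x\<in>\<Lambda>. x \<noteq> 0 \<and> x \<in> (*\<^sub>R) r ` M)"
  have "0 \<in> M"
    using M(3) interior_subset by blast
  have "\<not> \<Lambda> \<subseteq> {0}"
  proof
    assume "\<Lambda> \<subseteq> {0}"
    then have "span \<Lambda> \<subseteq> {0}"
      by (metis span_empty span_insert_0 span_mono)
    then have "(UNIV :: 'a set) = {0}"
      using \<Lambda> by (auto simp: full_rank_lattice_def)
    then show False
      by (metis UNIV_I nonempty_Basis nonzero_Basis all_not_in_conv singletonD)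
  qed
  then obtain v where v: "v \<in> \<Lambda>" "v \<noteq> 0"
    by blast
  obtain s where s: "s > 0" "v \<in> (*\<^sub>R) s ` M"
    using exists_scaling_contains[OF M(3), of "{v}"] by auto
  define F where "F = \<Lambda> \<inter> (*\<^sub>R) s ` M - {0}"
  have "finite F"
    unfolding F_def using full_rank_lattice_finite_bounded[OF \<Lambda>] M(1)
    by (simp add: bounded_scaling compact_imp_bounded)
  define Z where "Z = ({0..s} \<times> M) \<inter> (\<lambda>p. fst p *\<^sub>R snd p) -` F"
  have "closed ((\<lambda>p::real \<times> 'a. fst p *\<^sub>R snd p) -` F)"
    using \<open>finite F\<close> by (intro closed_vimage finite_imp_closed continuous_intros)
  then have "compact Z"
    unfolding Z_def by (intro compact_Int_closed compact_Times M compact_Icc)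
  then have "compact (fst ` Z)"
    by (intro compact_continuous_image continuous_intros)
  have Z_iff: "r \<in> fst ` Z \<longleftrightarrow> ?P r \<and> r \<le> s" for r
  proof
    assume "r \<in> fst ` Z"
    then obtain x where "0 \<le> r" "r \<le> s" "x \<in> M" "r *\<^sub>R x \<in> F"
      by (auto simp: Z_def)
    moreover from this have "r *\<^sub>R x \<in> \<Lambda>" "r *\<^sub>R x \<noteq> 0"
      by (auto simp: F_def)
    moreover from this have "r \<noteq> 0" "r *\<^sub>R x \<in> (*\<^sub>R) r ` M"
      using \<open>x \<in> M\<close> by auto
    ultimately show "?P r \<and> r \<le> s"
      by (intro conjI bexI[of _ "r *\<^sub>R x"]) simp_all
  next
    assume r: "?P r \<and> r \<le> s"
    then obtain x where x: "x \<in> M" "r *\<^sub>R x \<in> \<Lambda>" "r *\<^sub>R x \<noteq> 0"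
      by blast
    then have "r *\<^sub>R x \<in> F"
      using convex_scaling_mono[OF M(2) \<open>0 \<in> M\<close>, of r s] r by (auto simp: F_def)
    then show "r \<in> fst ` Z"
      using r x by (intro image_eqI[of _ _ "(r, x)"]) (auto simp: Z_def)
  qed
  have "s \<in> fst ` Z"
    unfolding Z_iff using s v by blast
  then obtain r where r: "r \<in> fst ` Z" "\<And>t. t \<in> fst ` Z \<Longrightarrow> r \<le> t"
    using compact_attains_inf[OF \<open>compact (fst ` Z)\<close>] by blast
  from r(1) have P: "?P r" and "r \<le> s"
    unfolding Z_iff by blast+
  have min: "r \<le> t" if "?P t" for t
  proof (cases "t \<le> s")
    case True
    with that show ?thesis
      by (intro r(2)) (unfold Z_iff, rule conjI)
  qed (use \<open>r \<le> s\<close> in simp)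
  have eq: "first_minimum M \<Lambda> = r"
    unfolding first_minimum_def by (rule Least_equality[where P = ?P, OF P min])
  show "0 < first_minimum M \<Lambda>" "\<exists>x\<in>\<Lambda>. x \<noteq> 0 \<and> x \<in> (*\<^sub>R) (first_minimum M \<Lambda>) ` M"
    unfolding eq using P by blast+
  show "first_minimum M \<Lambda> \<le> t" if "0 < t" "x \<in> \<Lambda>" "x \<noteq> 0" "x \<in> (*\<^sub>R) t ` M" for t x
    unfolding eq using that by (intro min conjI bexI[of _ x])
qed

lemma mult_power_limit_le:
  fixes X Y :: real
  assumes "\<And>\<theta>. 0 < \<theta> \<Longrightarrow> \<theta> < 1 \<Longrightarrow> \<theta> ^ n * X \<le> Y"
  shows "X \<le> Y"
proof (rule tendsto_upperbound)
  show "((\<lambda>\<theta>. \<theta> ^ n * X) \<longlongrightarrow> X) (at_left 1)"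
    by (rule tendsto_eq_intros refl | simp)+
  show "\<forall>\<^sub>F \<theta> in at_left 1. \<theta> ^ n * X \<le> Y"
    using assms by (auto simp: eventually_at_left[of 0] intro!: exI[of _ 0])
qed simp

lemma measure_scaling:
  fixes K :: "'a::euclidean_space set"
  assumes "0 \<le> r"
  shows "measure lebesgue ((*\<^sub>R) r ` K) = r ^ DIM('a) * measure lebesgue K"
  using measure_lebesgue_affine[of r 0 K] assms by simp

lemma packing_density_le_1:
  fixes K \<Lambda> :: "'a::euclidean_space set"
  assumes K: "convex_body K" and \<Lambda>: "full_rank_lattice \<Lambda>"
  shows "measure lebesgue ((*\<^sub>R) (first_minimum (difference_body K) \<Lambda>) ` K) / lattice_det \<Lambda> \<le> 1"
proof -
  let ?l = "first_minimum (difference_body K) \<Lambda>"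
  note first = first_minimum_props[OF \<Lambda> difference_body_props[OF K]]
  obtain B where B: "lattice_basis B \<Lambda>"
    using lattice_basis_exists[OF \<Lambda>] by blast
  have compact: "compact ((*\<^sub>R) r ` K)" for r
    using K by (auto simp: convex_body_def intro: compact_scaling)
  have le: "measure lebesgue ((*\<^sub>R) r ` K) \<le> lattice_det \<Lambda>" if r: "0 < r" "r < ?l" for r
    unfolding lattice_det_eq[OF \<Lambda> B]
  proof (rule lattice_packing_measure_le[OF \<Lambda> B])
    fix x y assume "x \<in> (*\<^sub>R) r ` K" "y \<in> (*\<^sub>R) r ` K" and xy: "x - y \<in> \<Lambda>"
    then obtain k l where kl: "k \<in> K" "l \<in> K" "x - y = r *\<^sub>R (k - l)"
      by (auto simp: algebra_simps)
    then have "x - y \<in> (*\<^sub>R) r ` difference_body K"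
      unfolding difference_body_def by blast
    then show "x = y"
      using first(3)[OF r(1) xy] r by auto
  qed (use compact in \<open>simp_all add: compact_imp_bounded lmeasurable_compact\<close>)
  have "\<theta> ^ DIM('a) * measure lebesgue ((*\<^sub>R) ?l ` K) \<le> lattice_det \<Lambda>" if "0 < \<theta>" "\<theta> < 1" for \<theta>
  proof -
    have "\<theta> ^ DIM('a) * measure lebesgue ((*\<^sub>R) ?l ` K) = measure lebesgue ((*\<^sub>R) (\<theta> * ?l) ` K)"
      using that first(1) by (simp add: measure_scaling power_mult_distrib)
    also have "\<dots> \<le> lattice_det \<Lambda>"
      using that first(1) by (intro le) simp_all
    finally show ?thesis .
  qed
  then have "measure lebesgue ((*\<^sub>R) ?l ` K) \<le> lattice_det \<Lambda>"
    by (rule mult_power_limit_le)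
  then show ?thesis
    using lattice_det_pos[OF \<Lambda>] by simp
qed

lemma le_lattice_packing_density:
  assumes "convex_body K" "full_rank_lattice \<Lambda>"
  shows "measure lebesgue ((*\<^sub>R) (first_minimum (difference_body K) \<Lambda>) ` K) / lattice_det \<Lambda>
    \<le> lattice_packing_density K"
  unfolding lattice_packing_density_def
  using assms packing_density_le_1 by (intro cSup_upper) (auto simp: bdd_above_def)

section \<open>Absorbing subspaces\<close>

definition absorbing :: "'a::euclidean_space set \<Rightarrow> 'a set \<Rightarrow> real \<Rightarrow> 'a set \<Rightarrow> bool" where
  "absorbing M \<Lambda> r L \<longleftrightarrow> subspace L \<and> ((*\<^sub>R) r ` M + L) \<inter> \<Lambda> \<subseteq> L"

lemma absorbing_antimono:
  assumes "convex M" "0 \<in> M" "0 \<le> r" "r \<le> s" "absorbing M \<Lambda> s L"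
  shows "absorbing M \<Lambda> r L"
proof -
  have "(*\<^sub>R) r ` M + L \<subseteq> (*\<^sub>R) s ` M + L"
    using convex_scaling_mono[OF assms(1-4)] by (rule set_plus_mono2) simp
  then show ?thesis
    using assms(5) by (auto simp: absorbing_def)
qed

definition absorbing_hull :: "'a::euclidean_space set \<Rightarrow> 'a set \<Rightarrow> real \<Rightarrow> 'a set" where
  "absorbing_hull M \<Lambda> r = \<Inter>{L. absorbing M \<Lambda> r L}"

lemma absorbing_absorbing_hull: "absorbing M \<Lambda> r (absorbing_hull M \<Lambda> r)"
proof -
  have "subspace (absorbing_hull M \<Lambda> r)"
    unfolding absorbing_hull_def by (rule subspace_Inter) (simp add: absorbing_def)
  moreover have "((*\<^sub>R) r ` M + absorbing_hull M \<Lambda> r) \<inter> \<Lambda> \<subseteq> L" if L: "absorbing M \<Lambda> r L" for L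
  proof -
    have "absorbing_hull M \<Lambda> r \<subseteq> L"
      using L by (auto simp: absorbing_hull_def)
    then have "(*\<^sub>R) r ` M + absorbing_hull M \<Lambda> r \<subseteq> (*\<^sub>R) r ` M + L"
      by (intro set_plus_mono2) simp
    then show ?thesis
      using L by (auto simp: absorbing_def)
  qed
  ultimately show ?thesis
    unfolding absorbing_def[of M \<Lambda> r "absorbing_hull M \<Lambda> r"] by (auto simp: absorbing_hull_def)
qed

lemma absorbing_hull_mono:
  assumes "convex M" "0 \<in> M" "0 \<le> r" "r \<le> s"
  shows "absorbing_hull M \<Lambda> r \<subseteq> absorbing_hull M \<Lambda> s"
  unfolding absorbing_hull_def using absorbing_antimono[OF assms] by blast

lemma extend_basis:
  fixes xs :: "'a::euclidean_space list"
  assumes "independent (set xs)" "distinct xs" "set xs \<subseteq> V" "subspace V"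
  obtains ys where "independent (set (xs @ ys))" "distinct (xs @ ys)" "span (set (xs @ ys)) = V"
proof -
  obtain B where B: "set xs \<subseteq> B" "B \<subseteq> V" "independent B" "V \<subseteq> span B"
    using maximal_independent_subset_extend[OF assms(3,1)] .
  have "finite (B - set xs)"
    using B(3) independent_imp_finite by blast
  then obtain ys where ys: "set ys = B - set xs" "distinct ys"
    using finite_distinct_list by blast
  have eq: "set (xs @ ys) = B"
    using ys B(1) by auto
  have "span B = V"
    using B assms(4) by (meson span_minimal subset_antisym)
  then show ?thesis
    using that[of ys] B(3) ys assms(2) unfolding eq by auto
qed

lemma chain_adapted_list:
  fixes U :: "nat \<Rightarrow> 'a::euclidean_space set"
  assumes sub: "\<And>k. subspace (U k)" and mono: "\<And>k. U k \<subseteq> U (Suc k)" and dim: "\<And>k. dim (U k) \<le> k"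
  shows "\<exists>xs. distinct xs \<and> independent (set xs) \<and> span (set xs) = U k \<and>
    (\<forall>j\<le>k. U j = span (set xs \<inter> U j)) \<and> (\<forall>i<length xs. xs ! i \<notin> U i)"
proof (induction k)
  case 0
  have "U 0 = {0}"
    using dim[of 0] sub[of 0] subspace_0 by auto
  then show ?case
    by (intro exI[of _ "[]"]) (simp add: independent_empty)
next
  case (Suc k)
  then obtain xs where xs: "distinct xs" "independent (set xs)" "span (set xs) = U k"
    "\<And>j. j \<le> k \<Longrightarrow> U j = span (set xs \<inter> U j)" "\<And>i. i < length xs \<Longrightarrow> xs ! i \<notin> U i"
    by blast
  have "set xs \<subseteq> U (Suc k)"
    using xs(3) mono[of k] span_superset by blast
  then obtain ys where ys: "independent (set (xs @ ys))" "distinct (xs @ ys)" "span (set (xs @ ys)) = U (Suc k)"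
    using extend_basis[OF xs(2,1) _ sub] by blast
  have U_le: "U i \<subseteq> U j" if "i \<le> j" for i j
    using lift_Suc_mono_le[of U] mono that by blast
  have "U j = span (set (xs @ ys) \<inter> U j)" if "j \<le> Suc k" for j
  proof (intro subset_antisym)
    show "span (set (xs @ ys) \<inter> U j) \<subseteq> U j"
      using sub by (intro span_minimal) auto
    show "U j \<subseteq> span (set (xs @ ys) \<inter> U j)"
    proof (cases "j = Suc k")
      case True
      have "set (xs @ ys) \<subseteq> U (Suc k)"
        using ys(3) span_superset by blast
      then show ?thesis
        using True ys(3) by (simp add: Int_absorb2)
    next
      case False
      then have "U j = span (set xs \<inter> U j)"
        using that xs(4) by simp
      then show ?thesis
        using span_mono[of "set xs \<inter> U j" "set (xs @ ys) \<inter> U j"] by auto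
    qed
  qed
  moreover have "(xs @ ys) ! i \<notin> U i" if i: "i < length (xs @ ys)" for i
  proof (cases "i < length xs")
    case True
    then show ?thesis
      using xs(5) by (simp add: nth_append)
  next
    case False
    have "length (xs @ ys) = dim (U (Suc k))"
      using ys by (metis dim_span_eq_card_independent distinct_card)
    then have "i \<le> k"
      using i dim[of "Suc k"] by simp
    have y: "(xs @ ys) ! i \<in> set ys"
      using False i by (simp add: nth_append)
    then have "(xs @ ys) ! i \<notin> span (set xs)"
    proof -
      have "set xs \<subseteq> set (xs @ ys) - {(xs @ ys) ! i}"
        using y ys(2) by auto
      moreover have "(xs @ ys) ! i \<notin> span (set (xs @ ys) - {(xs @ ys) ! i})"
        using ys(1) i unfolding dependent_def by (meson nth_mem)
      ultimately show ?thesis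
        using span_mono by blast
    qed
    then show ?thesis
      using U_le[OF \<open>i \<le> k\<close>] xs(3) by blast
  qed
  ultimately show ?case
    using ys by (intro exI[of _ "xs @ ys"]) blast
qed

lemma packing_minimum_bounds:
  fixes M \<Lambda> :: "'a::euclidean_space set"
  assumes \<Lambda>: "full_rank_lattice \<Lambda>" and M: "compact M" "convex M" "0 \<in> interior M"
    and i: "1 \<le> i" "i \<le> DIM('a)"
  shows "0 < packing_minimum i M \<Lambda>"
    and "\<And>r. 0 < r \<Longrightarrow> r < packing_minimum i M \<Lambda> \<Longrightarrow> \<exists>L. dim L = DIM('a) - i \<and> absorbing M \<Lambda> r L"
proof -
  define R where "R = {r. 0 < r \<and> (\<forall>L. subspace L \<and> dim L = DIM('a) - i \<longrightarrow>
            ((*\<^sub>R) r ` M + L) \<inter> \<Lambda> \<noteq> L \<inter> \<Lambda>)}"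
  have pm: "packing_minimum i M \<Lambda> = Inf R"
    by (simp add: packing_minimum_def R_def)
  have "0 \<in> M"
    using M(3) interior_subset by blast
  have R_iff: "r \<in> R \<longleftrightarrow> \<not> (\<exists>L. dim L = DIM('a) - i \<and> absorbing M \<Lambda> r L)" if "0 < r" for r
  proof -
    have "L \<subseteq> (*\<^sub>R) r ` M + L" for L
      using set_zero_plus2[of "(*\<^sub>R) r ` M" L] \<open>0 \<in> M\<close> by force
    then have "((*\<^sub>R) r ` M + L) \<inter> \<Lambda> = L \<inter> \<Lambda> \<longleftrightarrow> ((*\<^sub>R) r ` M + L) \<inter> \<Lambda> \<subseteq> L" for L
      by blast
    then show ?thesis
      using that by (auto simp: R_def absorbing_def)
  qed
  have bdd: "bdd_below R"
    by (rule bdd_belowI[of _ 0]) (simp add: R_def)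
  show "\<exists>L. dim L = DIM('a) - i \<and> absorbing M \<Lambda> r L" if "0 < r" "r < packing_minimum i M \<Lambda>" for r
    using that R_iff cInf_lower[OF _ bdd] unfolding pm by (meson not_le)
  obtain B where "lattice_basis B \<Lambda>"
    using lattice_basis_exists[OF \<Lambda>] by blast
  note B = lattice_basis_props[OF \<Lambda> this]
  have "R \<noteq> {}"
  proof -
    obtain r where r: "r > 0" "B \<subseteq> (*\<^sub>R) r ` M"
      using exists_scaling_contains[OF M(3) B(2)] by blast
    have "\<not> absorbing M \<Lambda> r L" if "dim L = DIM('a) - i" for L
    proof
      assume L: "absorbing M \<Lambda> r L"
      then have "subspace L"
        by (simp add: absorbing_def)
      have "B \<subseteq> ((*\<^sub>R) r ` M + L) \<inter> \<Lambda>"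
        using r(2) B(3) set_zero_plus2[of L "(*\<^sub>R) r ` M"] subspace_0[OF \<open>subspace L\<close>]
        by (force simp: add.commute)
      then have "span B \<subseteq> L"
        using L by (intro span_minimal) (auto simp: absorbing_def)
      then show False
        using that i B(4) by (simp add: top.extremum_unique)
    qed
    then show ?thesis
      using R_iff[OF r(1)] by blast
  qed
  have "card B = DIM('a)"
    using B(1,4) by (metis dim_UNIV dim_span_eq_card_independent)
  then obtain B' where B': "B' \<subseteq> B" "card B' = DIM('a) - i"
    using B(2) by (metis diff_le_self obtain_subset_with_card_n)
  define L where "L = span B'"
  have dim_L: "dim L = DIM('a) - i"
    unfolding L_def using B(1) B' by (metis dim_span_eq_card_independent independent_mono)
  have "compact ((\<lambda>x. representation B x b) ` M)" for b
    using continuous_on_representation[OF B(1,4)] M(1) by (rule compact_continuous_image)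
  then have "bounded (\<Union>b\<in>B. (\<lambda>x. representation B x b) ` M)"
    using B(2) by (intro bounded_UN ballI compact_imp_bounded)
  then obtain C where C: "C > 0" "\<And>b x. b \<in> B \<Longrightarrow> x \<in> M \<Longrightarrow> \<bar>representation B x b\<bar> \<le> C"
    unfolding bounded_pos by auto
  have absorb: "absorbing M \<Lambda> r L" if "0 < r" "r < 1 / C" for r
    unfolding absorbing_def
  proof (intro conjI subsetI)
    show "subspace L"
      by (simp add: L_def)
    fix v assume "v \<in> ((*\<^sub>R) r ` M + L) \<inter> \<Lambda>"
    then obtain x y where v: "v \<in> \<Lambda>" "x \<in> M" "y \<in> L" "v = r *\<^sub>R x + y"
      by (auto elim!: set_plus_elim)
    obtain z :: "'a \<Rightarrow> int" where z: "v = (\<Sum>b\<in>B. of_int (z b) *\<^sub>R b)"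
      using v(1) \<open>lattice_basis B \<Lambda>\<close> by (auto simp: lattice_basis_def)
    have "z b = 0" if b: "b \<in> B - B'" for b
    proof -
      have "representation B y = representation B' y"
        using B(1) B'(1) v(3) unfolding L_def by (intro representation_extend)
      then have "representation B y b = 0"
        using b representation_ne_zero by fastforce
      then have "of_int (z b) = r * representation B x b"
        using representation_sum_basis[OF B(1,2), of b "\<lambda>b. of_int (z b)"] b B(4)
        by (simp add: z[symmetric] v(4) representation_add[OF B(1)] representation_scale[OF B(1)])
      moreover have "\<bar>r * representation B x b\<bar> \<le> r * C"
        using C(2)[of b x] b v(2) \<open>0 < r\<close> by (simp add: abs_mult)
      moreover have "r * C < 1"
        using \<open>r < 1 / C\<close> C(1) by (simp add: field_simps)
      ultimately have "\<bar>real_of_int (z b)\<bar> < 1"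
        by linarith
      then show ?thesis
        by linarith
    qed
    then have "v = (\<Sum>b\<in>B'. of_int (z b) *\<^sub>R b)"
      unfolding z using B(2) B'(1) by (intro sum.mono_neutral_right) auto
    then show "v \<in> L"
      unfolding L_def by (simp add: span_sum span_scale span_base)
  qed
  have "1 / C \<le> Inf R"
  proof (rule cInf_greatest[OF \<open>R \<noteq> {}\<close>])
    fix r assume "r \<in> R"
    then show "1 / C \<le> r"
      using absorb dim_L R_iff[of r] by (force simp: R_def)
  qed
  then show "0 < packing_minimum i M \<Lambda>"
    unfolding pm using C(1) by (meson divide_pos_pos less_le_trans zero_less_one)
qed

lemma packing_density_ge_prod:
  fixes K \<Lambda> :: "(real^'n) set"
  assumes K: "convex_body K" and \<Lambda>: "full_rank_lattice \<Lambda>"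
    and r: "\<And>k. k < CARD('n) \<Longrightarrow> 0 < r k"
    and absorb: "\<And>k. k < CARD('n) \<Longrightarrow> \<exists>L. dim L = k \<and> absorbing (difference_body K) \<Lambda> (r k) L"
  shows "(\<Prod>k<CARD('n). r k) * measure lebesgue K / lattice_det \<Lambda> \<le> lattice_packing_density K"
proof -
  let ?n = "CARD('n)"
  define M where "M = difference_body K"
  note M = difference_body_props[OF K, folded M_def]
  have "0 \<in> M"
    using M(3) interior_subset by blast
  define R where "R k = Max (r ` {..k})" for k
  define U where "U k = (if k < ?n then absorbing_hull M \<Lambda> (R k) else UNIV)" for k
  have R_ge: "r k \<le> R k" for k
    by (simp add: R_def)
  have R_mono: "R k \<le> R (Suc k)" for k
    unfolding R_def by (intro Max_mono) auto
  have absorb_U: "absorbing M \<Lambda> (R k) (U k)" if "k < ?n" for k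
    using that absorbing_absorbing_hull by (simp add: U_def)
  have sub: "subspace (U k)" for k
    using absorb_U by (cases "k < ?n") (auto simp: absorbing_def U_def)
  have mono: "U k \<subseteq> U (Suc k)" for k
  proof (cases "Suc k < ?n")
    case True
    then have "0 \<le> R k"
      using r[of k] R_ge[of k] by simp
    then show ?thesis
      using True absorbing_hull_mono[OF M(2) \<open>0 \<in> M\<close> _ R_mono, of k \<Lambda>] by (simp add: U_def)
  qed (simp add: U_def)
  have dim: "dim (U k) \<le> k" for k
  proof (cases "k < ?n")
    case True
    have "R k \<in> r ` {..k}"
      unfolding R_def by (intro Max_in) auto
    then obtain j where j: "j \<le> k" "R k = r j"
      by auto
    then obtain L where L: "dim L = j" "absorbing M \<Lambda> (R k) L"
      using absorb[of j] True by (auto simp: M_def)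
    then have "U k \<subseteq> L"
      using True by (auto simp: U_def absorbing_hull_def)
    then show ?thesis
      using L(1) j(1) dim_subset by (metis order_trans)
  qed (simp add: U_def)
  obtain xs where xs: "distinct xs" "independent (set xs)" "span (set xs) = U ?n"
    "\<And>j. j \<le> ?n \<Longrightarrow> U j = span (set xs \<inter> U j)" "\<And>i. i < length xs \<Longrightarrow> xs ! i \<notin> U i"
    using chain_adapted_list[of U ?n, OF sub mono dim] by blast
  define B where "B = set xs"
  have B: "independent B" "finite B" "span B = UNIV"
    using xs(2,3) by (auto simp: B_def U_def)
  have len: "length xs = ?n"
    using B(1,3) xs(1) by (metis B_def DIM_cart DIM_real dim_UNIV dim_span_eq_card_independent distinct_card mult.right_neutral)
  define c where "c v = Max (R ` {k. k < ?n \<and> v \<notin> U k})" for v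
  have c_ge: "R k \<le> c v" if "k < ?n" "v \<notin> U k" for k v
    unfolding c_def using that by (intro Max_ge) auto
  have c_r: "r i \<le> c (xs ! i)" if "i < ?n" for i
    using c_ge[of i "xs ! i"] xs(5)[of i] R_ge[of i] len that by simp
  have c_pos: "0 < c v" if "v \<in> B" for v
    using that c_r r len unfolding B_def in_set_conv_nth by (metis order_less_le_trans)
  obtain f where f: "linear f" "\<And>v. v \<in> B \<Longrightarrow> f v = (1 / c v) *\<^sub>R v"
    using linear_independent_extend[OF B(1), of "\<lambda>v. (1 / c v) *\<^sub>R v"] by blast
  obtain g where g: "linear g" "\<And>v. v \<in> B \<Longrightarrow> g v = c v *\<^sub>R v"
    using linear_independent_extend[OF B(1), of "\<lambda>v. c v *\<^sub>R v"] by blast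
  have gf: "g (f x) = x" for x
  proof -
    have "(g \<circ> f) x = id x"
    proof (rule linear_eq_on[of "g \<circ> f" id x B])
      show "(g \<circ> f) v = id v" if "v \<in> B" for v
        using that f(2) g(2) c_pos[OF that] by (simp add: linear_scale[OF g(1)])
    qed (use B(3) in \<open>simp_all add: linear_compose f(1) g(1) linear_id\<close>)
    then show ?thesis
      by simp
  qed
  then have "inj f"
    by (rule inj_on_inverseI)
  note \<Lambda>' = full_rank_lattice_linear_image[OF f(1) \<open>inj f\<close> \<Lambda>]
  have no_points: "y = 0" if y: "y \<in> f ` \<Lambda>" "y \<in> M" for y
  proof (rule ccontr)
    assume "y \<noteq> 0"
    let ?t = "representation B y"
    have y_eq: "y = (\<Sum>v\<in>B. ?t v *\<^sub>R v)"
      using sum_representation[OF B(1,2,3)] by simp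
    define S where "S = {v \<in> B. ?t v \<noteq> 0}"
    have "S \<noteq> {}"
    proof
      assume "S = {}"
      then have "(\<Sum>v\<in>B. ?t v *\<^sub>R v) = 0"
        by (intro sum.neutral) (auto simp: S_def)
      then show False
        using y_eq \<open>y \<noteq> 0\<close> by simp
    qed
    moreover have "finite S"
      using B(2) by (simp add: S_def)
    ultimately have "Max (c ` S) \<in> c ` S" and "\<And>v. v \<in> S \<Longrightarrow> c v \<le> Max (c ` S)"
      by simp_all
    then obtain w where w: "w \<in> S" "\<And>v. v \<in> S \<Longrightarrow> c v \<le> c w"
      by (metis (no_types, lifting) imageE)
    obtain l where l: "l < ?n" "w = xs ! l"
      using w(1) len unfolding S_def B_def by (auto simp: in_set_conv_nth)
    then have "w \<notin> U l"
      using xs(5) len by simp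
    then have "c w \<in> R ` {k. k < ?n \<and> w \<notin> U k}"
      unfolding c_def using l(1) by (intro Max_in) auto
    then obtain k where k: "k < ?n" "w \<notin> U k" "c w = R k"
      by blast
    have "g y = g (\<Sum>v\<in>B. ?t v *\<^sub>R v)"
      by (rule arg_cong[OF y_eq])
    also have "\<dots> = (\<Sum>v\<in>B. (?t v * c v) *\<^sub>R v)"
      by (simp add: linear_sum[OF g(1)] linear_scale[OF g(1)] g(2))
    also have "\<dots> = R k *\<^sub>R (\<Sum>v\<in>B. ?t v *\<^sub>R v) + (\<Sum>v\<in>B. (?t v * (c v - R k)) *\<^sub>R v)"
      by (simp add: scaleR_sum_right sum.distrib[symmetric] algebra_simps)
    also have "(\<Sum>v\<in>B. ?t v *\<^sub>R v) = y"
      by (rule y_eq[symmetric])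
    finally have g_y: "g y = R k *\<^sub>R y + (\<Sum>v\<in>B. (?t v * (c v - R k)) *\<^sub>R v)" .
    have "(?t v * (c v - R k)) *\<^sub>R v \<in> U k" if v: "v \<in> B" for v
    proof (cases "v \<in> U k \<or> ?t v = 0")
      case True
      then show ?thesis
        using sub[of k] by (auto intro: subspace_scale subspace_0)
    next
      case False
      then have "c v = R k"
        using c_ge[OF k(1)] w(2)[of v] v k(3) by (auto simp: S_def intro: antisym)
      then show ?thesis
        using sub[of k] by (simp add: subspace_0)
    qed
    then have rest: "(\<Sum>v\<in>B. (?t v * (c v - R k)) *\<^sub>R v) \<in> U k"
      by (intro subspace_sum sub)
    have "g y \<in> \<Lambda>"
      using y(1) gf by auto
    moreover have "g y \<in> (*\<^sub>R) (R k) ` M + U k"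
      unfolding g_y using y(2) rest by (intro set_plus_intro imageI)
    ultimately have "g y \<in> U k"
      using absorb_U[OF k(1)] by (auto simp: absorbing_def)
    then have "g y - (\<Sum>v\<in>B. (?t v * (c v - R k)) *\<^sub>R v) \<in> U k"
      using rest by (intro subspace_diff sub)
    then have "R k *\<^sub>R y \<in> U k"
      unfolding g_y by simp
    moreover have "R k > 0"
      using r[OF k(1)] R_ge[of k] by linarith
    ultimately have "y \<in> U k"
      using subspace_scale[OF sub[of k] \<open>R k *\<^sub>R y \<in> U k\<close>, of "1 / R k"] by simp
    then have "y \<in> span (B \<inter> U k)"
      using xs(4)[of k] k(1) by (simp add: B_def)
    then have "?t = representation (B \<inter> U k) y"
      by (rule representation_extend[OF B(1)]) simp
    then have "representation (B \<inter> U k) y w \<noteq> 0"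
      using w(1) by (simp add: S_def)
    from representation_ne_zero[OF this] show False
      using k(2) by simp
  qed
  let ?l = "first_minimum M (f ` \<Lambda>)"
  note first = first_minimum_props[OF \<Lambda>' M]
  have "1 \<le> ?l"
  proof (rule ccontr)
    assume "\<not> 1 \<le> ?l"
    then have "(*\<^sub>R) ?l ` M \<subseteq> (*\<^sub>R) 1 ` M"
      using first(1) by (intro convex_scaling_mono M \<open>0 \<in> M\<close>) simp_all
    then show False
      using first(2) no_points by auto
  qed
  obtain e where e: "bij_betw e (UNIV :: 'n set) {0..<?n}"
    using ex_bij_betw_finite_nat[of "UNIV :: 'n set"] by auto
  define b where "b i = xs ! e i" for i
  have e_less: "e i < ?n" for i
    using bij_betwE[OF e] by auto
  have bij_b: "bij_betw b UNIV B"
  proof -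
    have "bij_betw ((!) xs) {0..<?n} B"
      using bij_betw_nth[OF xs(1)] len by (simp add: B_def lessThan_atLeast0)
    from bij_betw_trans[OF e this] show ?thesis
      by (simp add: b_def comp_def cong: bij_betw_cong)
  qed
  have "0 < c (b i)" for i
    using c_pos bij_b by (auto simp: bij_betw_def)
  then have prod_pos: "0 < (\<Prod>i\<in>UNIV. c (b i))"
    by (simp add: prod_pos)
  have "lattice_det (f ` \<Lambda>) = \<bar>\<Prod>i\<in>UNIV. 1 / c (b i)\<bar> * lattice_det \<Lambda>"
  proof (rule lattice_det_diagonal_image[OF f(1) \<open>inj f\<close> _ _ _ \<Lambda>])
    show "f (b i) = (1 / c (b i)) *\<^sub>R b i" for i
      using bij_b f(2) by (auto simp: bij_betw_def)
    show "inj b" "independent (range b)"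
      using bij_b B(1) by (auto simp: bij_betw_def)
  qed
  also have "(\<Prod>i\<in>UNIV. 1 / c (b i)) = 1 / (\<Prod>i\<in>UNIV. c (b i))"
    by (simp add: prod_dividef)
  finally have det: "lattice_det (f ` \<Lambda>) = lattice_det \<Lambda> / (\<Prod>i\<in>UNIV. c (b i))"
    using prod_pos by simp
  have "(\<Prod>k<?n. r k) = (\<Prod>i\<in>UNIV. r (e i))"
    using prod.reindex_bij_betw[OF e, of r] by (simp add: lessThan_atLeast0)
  also have "\<dots> \<le> (\<Prod>i\<in>UNIV. c (b i))"
    using r c_r e_less by (intro prod_mono) (simp add: b_def less_imp_le)
  finally have prod_le: "(\<Prod>k<?n. r k) \<le> (\<Prod>i\<in>UNIV. c (b i))" .
  have "(\<Prod>k<?n. r k) * measure lebesgue K / lattice_det \<Lambda> \<le> (\<Prod>i\<in>UNIV. c (b i)) * measure lebesgue K / lattice_det \<Lambda>"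
    using prod_le lattice_det_pos[OF \<Lambda>] by (intro divide_right_mono mult_right_mono) simp_all
  also have "\<dots> = measure lebesgue K / lattice_det (f ` \<Lambda>)"
    by (simp add: det)
  also have "\<dots> \<le> measure lebesgue ((*\<^sub>R) ?l ` K) / lattice_det (f ` \<Lambda>)"
  proof (rule divide_right_mono)
    have "1 * measure lebesgue K \<le> ?l ^ ?n * measure lebesgue K"
      using \<open>1 \<le> ?l\<close> by (intro mult_right_mono one_le_power) simp_all
    then show "measure lebesgue K \<le> measure lebesgue ((*\<^sub>R) ?l ` K)"
      using \<open>1 \<le> ?l\<close> by (simp add: measure_scaling)
  qed (use lattice_det_pos[OF \<Lambda>'] in simp)
  also have "\<dots> \<le> lattice_packing_density K"
    unfolding M_def by (rule le_lattice_packing_density[OF K \<Lambda>'])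
  finally show ?thesis .
qed

theorem theorem1p2:
  fixes K \<Lambda> :: "(real ^ 'n) set"
  assumes "convex_body K"
    and "full_rank_lattice \<Lambda>"
  shows "measure lebesgue K / lattice_det \<Lambda> \<le>
    lattice_packing_density K *
      (\<Prod>i = 1..CARD('n). 1 / packing_minimum i (difference_body K) \<Lambda>)"
proof -
  let ?n = "CARD('n)"
  define \<rho> where "\<rho> i = packing_minimum i (difference_body K) \<Lambda>" for i
  note bounds = packing_minimum_bounds[OF assms(2) difference_body_props[OF assms(1)], folded \<rho>_def]
  have pos: "0 < \<rho> i" if "1 \<le> i" "i \<le> ?n" for i
    using bounds(1) that by simp
  have reindex: "(\<Prod>k<?n. \<rho> (?n - k)) = (\<Prod>i = 1..?n. \<rho> i)"
    by (rule prod.reindex_bij_witness[of _ "\<lambda>i. ?n - i" "\<lambda>k. ?n - k"]) auto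
  have "\<theta> ^ ?n * ((\<Prod>i = 1..?n. \<rho> i) * measure lebesgue K / lattice_det \<Lambda>) \<le> lattice_packing_density K"
    if \<theta>: "0 < \<theta>" "\<theta> < 1" for \<theta>
  proof -
    have "(\<Prod>k<?n. \<theta> * \<rho> (?n - k)) * measure lebesgue K / lattice_det \<Lambda> \<le> lattice_packing_density K"
    proof (rule packing_density_ge_prod[OF assms])
      fix k assume k: "k < ?n"
      then show "0 < \<theta> * \<rho> (?n - k)"
        using \<theta> pos[of "?n - k"] by simp
      then show "\<exists>L. dim L = k \<and> absorbing (difference_body K) \<Lambda> (\<theta> * \<rho> (?n - k)) L"
        using bounds(2)[of "?n - k" "\<theta> * \<rho> (?n - k)"] k \<theta> pos[of "?n - k"] by simp
    qed
    then show ?thesis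
      by (simp add: prod.distrib reindex mult.assoc)
  qed
  then have "(\<Prod>i = 1..?n. \<rho> i) * measure lebesgue K / lattice_det \<Lambda> \<le> lattice_packing_density K"
    by (rule mult_power_limit_le)
  moreover have "0 < (\<Prod>i = 1..?n. \<rho> i)"
    using pos by (intro prod_pos) simp
  ultimately have "measure lebesgue K / lattice_det \<Lambda> \<le> lattice_packing_density K / (\<Prod>i = 1..?n. \<rho> i)"
    by (simp add: field_simps)
  then show ?thesis
    by (simp add: \<rho>_def prod_dividef)
qed

end
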